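(* Let $I\ge 2$, $\lambda>0$, $\{1\}\subseteq B\subseteq\{1,\ldots,\lfloor I/2\rfloor\}$, $z_0\in\mathrm{dom}\,h$, and let $\Gamma_I$ be the $I$-th (last) model generated by the method S-Max1C with input $(\lambda,I,B,z_0)$. Then for every $u\in\mathrm{dom}\,h$, $$\mathcal{N}(u;\Gamma_I)\le 4\sigma(u)\sqrt{|B|-1}\,\frac{\sqrt{\log(I+1)}}{\sqrt{I+1}}.$$
   Context: Problem: $\phi_*:=\min\{\phi(x):=f(x)+h(x):x\in\mathbb{R}^n\}$ with $f(x)=\mathbb{E}_\xi[F(x,\xi)]$, where $\xi$ is a random vector with support $\Xi$. $\log$ is the natural logarithm, $\|\cdot\|$ the Euclidean norm, and $\mathrm{dom}\,\psi=\{x:\psi(x)<\infty\}$. Standing assumptions. (i) $f,h:\mathbb{R}^n\to\mathbb{R}\cup\{+\infty\}$ are proper closed convex functions with $\mathrm{dom}\,h\subseteq\mathrm{dom}\,f$. (ii) For almost every $\xi\in\Xi$ a convex function $F(\cdot,\xi):\mathrm{dom}\,h\to\mathbb{R}$ and a map $s(\cdot,\xi):\mathrm{dom}\,h\to\mathbb{R}^n$ are available such that for every $x\in\mathrm{dom}\,h$, $f(x)=\mathbb{E}[F(x,\xi)]$ and $s(x,\xi)\in\partial F(x,\xi)$, i.e. $F(u,\xi)\ge F(x,\xi)+\langle s(x,\xi),u-x\rangle$ for all $u\in\mathrm{dom}\,h$. (iii) $M:=\sup\{\mathbb{E}[\|s(x,\xi)\|^2]^{1/2}:x\in\mathrm{dom}\,h\}<\infty$.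 (iv) The set $X_*$ of minimizers of $\phi$ is nonempty. Notation. $\Phi(\cdot;\xi)=F(\cdot,\xi)+h(\cdot)$; $\ell(\cdot,x;\xi)=F(x,\xi)+h(\cdot)+\langle s(x,\xi),\cdot-x\rangle$; $\sigma(u)=\sqrt{\mathbb{E}[(\Phi(u;\xi)-\phi(u))^2]}$; the model noise at $u\in\mathrm{dom}\,h$ is $\mathcal{N}(u;\Gamma_j)=\max\{0,\mathbb{E}[\Gamma_j(u)]-\phi(u)\}$. All random quantities are measurable, the expectations are understood to be well defined, and $0\cdot\infty=0$. Method S-Max1C. Input: $\lambda>0$, integer $I\ge 2$, set $B$ with $\{1\}\subseteq B\subseteq\{1,\ldots,\lfloor I/2\rfloor\}$, $z_0\in\mathrm{dom}\,h$. Let $\beta=\frac{I+1-\log(I+1)}{I+1+\log(I+1)}$ and let $\xi_0,\xi_1,\ldots,\xi_I$ be independent samples of $\xi$. For $j=1,\ldots,I$: (1) $\Gamma_1(\cdot)=\ell(\cdot,z_0;\xi_0)$; for $j\ge2$ with $j\in B$, $\Gamma_j(\cdot)=(1-\beta)\ell(\cdot,z_{j-1};\xi_{j-1})+\beta\max\{\Gamma_{j-1}(\cdot),\ell(\cdot,z_{j-1};\xi_{j-1})\}$; for $j\ge 2$ with $j\notin B$, $\Gamma_j(\cdot)=(1-\beta)\ell(\cdot,z_{j-1};\xi_{j-1})+\beta\Gamma_{j-1}(\cdot)$; (2) $z_j=\mathrm{argmin}_{u\in\mathbb{R}^n}\{\Gamma_j(u)+\frac{1}{2\lambda}\|u-z_0\|^2\}$.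 (The method also computes averages of iterates and of observed function values, which are not needed here.) Equivalently, $\Gamma_j=\max_{k\in B,\,k\le j}L_k^j$ with $L_k^j(\cdot)=\sum_{i=k}^j\beta_i^j\,\ell(\cdot,z_{i-1};\xi_{i-1})$, where $\beta_k^j=\beta^{j-k}$ and $\beta_i^j=(1-\beta)\beta^{j-i}$ for $i=k+1,\ldots,j$. *)

theory Defs
  imports "HOL-Probability.Probability"
begin

section \<open>Extended-real-valued convex functions\<close>

definition effective_domain :: "('a \<Rightarrow> ereal) \<Rightarrow> 'a set" where
  "effective_domain p = {x. p x < \<infinity>}"

definition ereal_epigraph :: "('a \<Rightarrow> ereal) \<Rightarrow> ('a \<times> real) set" where
  "ereal_epigraph p = {(x, t). p x \<le> ereal t}"

definition proper_closed_convex :: "('a::euclidean_space \<Rightarrow> ereal) \<Rightarrow> bool" where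
  "proper_closed_convex p \<longleftrightarrow>
     (\<forall>x. p x \<noteq> -\<infinity>) \<and> (\<exists>x. p x \<noteq> \<infinity>) \<and>
     closed (ereal_epigraph p) \<and> convex (ereal_epigraph p)"


section \<open>Extended-real-valued expectations\<close>

text \<open>
  The expectation of an extended-real random variable is the difference of the integrals of its
  positive and negative parts (\<open>e2ennreal\<close> maps negative numbers to 0), so no integrability is
  built into the notion.  It agrees with the Bochner integral on integrable real random variables,
  see the lemma below.  If both parts have infinite integral, the value is \<open>\<infinity>\<close>,
  because \<open>\<infinity> - \<infinity> = \<infinity>\<close> in type \<open>ereal\<close>.
\<close>

definition ereal_expectation :: "'w measure \<Rightarrow> ('w \<Rightarrow> ereal) \<Rightarrow> ereal" where
  "ereal_expectation M X =
     enn2ereal (\<integral>\<^sup>+\<omega>. e2ennreal (X \<omega>) \<partial>M) - enn2ereal (\<integral>\<^sup>+\<omega>. e2ennreal (- X \<omega>) \<partial>M)"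

lemma ereal_expectation_eq_integral:
  fixes X :: "'w \<Rightarrow> real"
  assumes "integrable M X"
  shows "ereal_expectation M (\<lambda>\<omega>. ereal (X \<omega>)) = ereal (\<integral>\<omega>. X \<omega> \<partial>M)"
proof -
  have fin: "(\<integral>\<^sup>+\<omega>. ennreal (X \<omega>) \<partial>M) \<noteq> \<infinity>" "(\<integral>\<^sup>+\<omega>. ennreal (- X \<omega>) \<partial>M) \<noteq> \<infinity>"
    using assms by (auto simp: real_integrable_def)
  have *: "enn2ereal y = ereal (enn2real y)" if "y \<noteq> \<infinity>" for y
    using that by (cases y) (auto simp: enn2ereal_ennreal)
  show ?thesis
    unfolding ereal_expectation_def real_lebesgue_integral_def[OF assms]
    using *[OF fin(1)] *[OF fin(2)] by (simp add: ennreal.abs_eq[symmetric])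
qed

definition ereal_sqrt :: "ereal \<Rightarrow> ereal" where
  "ereal_sqrt y = (if y = \<infinity> then \<infinity> else ereal (sqrt (real_of_ereal y)))"

text \<open>\<open>l2_size D X\<close> is \<open>E[X\<^sup>2]\<^sup>1\<^sup>/\<^sup>2\<close>, a value in \<open>[0, \<infinity>]\<close>.\<close>

definition l2_size :: "'w measure \<Rightarrow> ('w \<Rightarrow> ereal) \<Rightarrow> ereal" where
  "l2_size D X = ereal_sqrt (ereal_expectation D (\<lambda>\<omega>. (X \<omega>)\<^sup>2))"


section \<open>The stochastic composite problem\<close>

text \<open>
  \<open>D\<close> is the law of the random vector \<open>\<xi>\<close>.  The oracles \<open>F\<close> and \<open>s\<close> are total
  functions, but only their values at points of the domain of \<open>h\<close> matter.
\<close>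

definition obj :: "('a \<Rightarrow> ereal) \<Rightarrow> ('a \<Rightarrow> ereal) \<Rightarrow> 'a \<Rightarrow> ereal" where
  "obj f h x = f x + h x"

definition stoch_obj :: "('a \<Rightarrow> ereal) \<Rightarrow> ('a \<Rightarrow> 'b \<Rightarrow> real) \<Rightarrow> 'a \<Rightarrow> 'b \<Rightarrow> ereal" where
  "stoch_obj h F u \<xi> = ereal (F u \<xi>) + h u"

definition stoch_lin ::
  "('a::euclidean_space \<Rightarrow> ereal) \<Rightarrow> ('a \<Rightarrow> 'b \<Rightarrow> real) \<Rightarrow> ('a \<Rightarrow> 'b \<Rightarrow> 'a) \<Rightarrow> 'a \<Rightarrow> 'b \<Rightarrow> 'a \<Rightarrow> ereal" where
  "stoch_lin h F s x \<xi> u = ereal (F x \<xi>) + h u + ereal (s x \<xi> \<bullet> (u - x))"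

definition noise_level ::
  "'b measure \<Rightarrow> ('a \<Rightarrow> ereal) \<Rightarrow> ('a \<Rightarrow> ereal) \<Rightarrow> ('a \<Rightarrow> 'b \<Rightarrow> real) \<Rightarrow> 'a \<Rightarrow> ereal" where
  "noise_level D f h F u = l2_size D (\<lambda>\<xi>. stoch_obj h F u \<xi> - obj f h u)"

text \<open>Here \<open>G \<omega>\<close> is the random model for the outcome \<open>\<omega>\<close>.\<close>

definition model_noise ::
  "'w measure \<Rightarrow> ('a \<Rightarrow> ereal) \<Rightarrow> ('a \<Rightarrow> ereal) \<Rightarrow> ('w \<Rightarrow> 'a \<Rightarrow> ereal) \<Rightarrow> 'a \<Rightarrow> ereal" where
  "model_noise M f h G u = max 0 (ereal_expectation M (\<lambda>\<omega>. G \<omega> u) - obj f h u)"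


section \<open>The method S-Max1C\<close>

definition smax_beta :: "nat \<Rightarrow> real" where
  "smax_beta N = (real N + 1 - ln (real N + 1)) / (real N + 1 + ln (real N + 1))"

text \<open>
  \<open>smax1c_run h F s lam N B z0 xs G z\<close> says that \<open>G 1, \<dots>, G N\<close> are the models and
  \<open>z 0 = z0, z 1, \<dots>, z N\<close> the iterates of a run of the method for the realized samples
  \<open>xs 0, \<dots>, xs N\<close>.  The objective in the prox subproblem is proper, closed and strongly convex
  whenever \<open>h\<close> is proper, closed and convex, so its minimizer exists and is unique.
\<close>

definition smax1c_run ::
  "('a::euclidean_space \<Rightarrow> ereal) \<Rightarrow> ('a \<Rightarrow> 'b \<Rightarrow> real) \<Rightarrow> ('a \<Rightarrow> 'b \<Rightarrow> 'a) \<Rightarrow>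
   real \<Rightarrow> nat \<Rightarrow> nat set \<Rightarrow> 'a \<Rightarrow> (nat \<Rightarrow> 'b) \<Rightarrow>
   (nat \<Rightarrow> 'a \<Rightarrow> ereal) \<Rightarrow> (nat \<Rightarrow> 'a) \<Rightarrow> bool" where
  "smax1c_run h F s lam N B z0 xs G z \<longleftrightarrow>
     z 0 = z0 \<and>
     (\<forall>u. G 1 u = stoch_lin h F s z0 (xs 0) u) \<and>
     (\<forall>j\<in>{2..N}. \<forall>u.
        let b = smax_beta N; l = stoch_lin h F s (z (j - 1)) (xs (j - 1)) u in
        G j u = ereal (1 - b) * l + ereal b * (if j \<in> B then max (G (j - 1) u) l else G (j - 1) u)) \<and>
     (\<forall>j\<in>{1..N}.
        is_arg_min (\<lambda>u. G j u + ereal (1 / (2 * lam) * (norm (u - z0))\<^sup>2)) (\<lambda>_. True) (z j))"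

end

theory Submission
  imports Defs
begin

text \<open>
  Fix a point \<open>u\<close> of the domain of \<open>h\<close>.  Almost surely the subgradient inequality bounds every
  linearization that enters the model by the observation \<open>y k = F u (xi k) + h u\<close>, so the
  last model at \<open>u\<close> is at most the result of the same recursion run on the observations
  (\<open>running_max\<close>).  The positions of the iterates no longer occur in that bound.

  Without maxima the recursion is a weighted average \<open>A\<close> of the observations, and its expectation
  is exactly \<open>\<phi> u\<close>.  A maximum taken at step \<open>k\<close> lifts the result above \<open>A\<close> by at most the
  positive part of the jump \<open>y k - A (k - 1)\<close>, and this step and each later one damp the
  excess by the factor \<open>\<beta>\<close>.  Since maxima of excesses do not accumulate, the total excess is at
  most the largest positive part of a damped jump, which is at most the root of the sum of the
  squares of all damped jumps (\<open>running_max_le_average_plus_jumps\<close>).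
  Each jump is a difference of two weighted averages of observations, so its second moment is at
  most \<open>4 \<sigma>\<^sup>2\<close>, and there are \<open>card B - 1\<close> of them; Jensen's inequality gives an
  expected excess of at most \<open>2 \<sigma> sqrt (card B - 1)\<close> times the damping.

  As all maxima are taken in the first half of the run, every jump is damped at least
  \<open>(N + 1) / 2\<close> times, and \<open>\<beta> \<le> exp (- ln (N + 1) / (N + 1))\<close> makes the total damping at most
  \<open>1 / sqrt (N + 1)\<close>.  This gives \<open>2 \<sigma> sqrt (card B - 1) / sqrt (N + 1)\<close>, which is below the claimed
  bound because \<open>ln (N + 1) \<ge> 1\<close>.
\<close>

section \<open>Extended-real expectations\<close>

lemma ereal_expectation_le_integral:
  fixes Y :: "'w \<Rightarrow> real"
  assumes "AE \<omega> in M. X \<omega> \<le> ereal (Y \<omega>)" and "integrable M Y"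
  shows "ereal_expectation M X \<le> ereal (\<integral>\<omega>. Y \<omega> \<partial>M)"
proof -
  have "ereal_expectation M X \<le> ereal_expectation M (\<lambda>\<omega>. ereal (Y \<omega>))"
    unfolding ereal_expectation_def
  proof (rule ereal_minus_mono)
    show "enn2ereal (\<integral>\<^sup>+\<omega>. e2ennreal (X \<omega>) \<partial>M) \<le> enn2ereal (\<integral>\<^sup>+\<omega>. e2ennreal (ereal (Y \<omega>)) \<partial>M)"
    proof (intro less_eq_ennreal.rep_eq[THEN iffD1] nn_integral_mono_AE)
      show "AE \<omega> in M. e2ennreal (X \<omega>) \<le> e2ennreal (ereal (Y \<omega>))"
        using assms(1) by eventually_elim (rule e2ennreal_mono)
    qed
    show "enn2ereal (\<integral>\<^sup>+\<omega>. e2ennreal (- ereal (Y \<omega>)) \<partial>M) \<le> enn2ereal (\<integral>\<^sup>+\<omega>. e2ennreal (- X \<omega>) \<partial>M)"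
    proof (intro less_eq_ennreal.rep_eq[THEN iffD1] nn_integral_mono_AE)
      show "AE \<omega> in M. e2ennreal (- ereal (Y \<omega>)) \<le> e2ennreal (- X \<omega>)"
        using assms(1) by eventually_elim (rule e2ennreal_mono, simp only: ereal_minus_le_minus)
    qed
  qed
  then show ?thesis
    using ereal_expectation_eq_integral[OF assms(2)] by simp
qed

text \<open>
  The convention \<open>\<infinity> - \<infinity> = \<infinity>\<close> is what makes this true: a finite value forces both the positive
  and the negative part to have a finite integral.
\<close>

lemma integrable_if_ereal_expectation_finite:
  fixes X :: "'w \<Rightarrow> real"
  assumes "X \<in> borel_measurable M"
    and "ereal_expectation M (\<lambda>\<omega>. ereal (X \<omega>)) \<noteq> \<infinity>"
    and "ereal_expectation M (\<lambda>\<omega>. ereal (X \<omega>)) \<noteq> - \<infinity>"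
  shows "integrable M X"
proof -
  have "(\<integral>\<^sup>+\<omega>. ennreal (X \<omega>) \<partial>M) \<noteq> \<infinity>"
    using assms(2) unfolding ereal_expectation_def by (auto simp: ennreal.abs_eq[symmetric])
  moreover have "(\<integral>\<^sup>+\<omega>. ennreal (- X \<omega>) \<partial>M) \<noteq> \<infinity>"
  proof
    assume "(\<integral>\<^sup>+\<omega>. ennreal (- X \<omega>) \<partial>M) = \<infinity>"
    then have "ereal_expectation M (\<lambda>\<omega>. ereal (X \<omega>)) = enn2ereal (\<integral>\<^sup>+\<omega>. ennreal (X \<omega>) \<partial>M) - \<infinity>"
      unfolding ereal_expectation_def by (simp add: ennreal.abs_eq[symmetric])
    then show False using assms(2,3) by (cases "enn2ereal (\<integral>\<^sup>+\<omega>. ennreal (X \<omega>) \<partial>M)") auto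
  qed
  ultimately show ?thesis using assms(1) by (simp add: real_integrable_def)
qed

lemma l2_size_finite:
  fixes X :: "'w \<Rightarrow> real"
  assumes "X \<in> borel_measurable M" and "l2_size M (\<lambda>\<omega>. ereal (X \<omega>)) \<noteq> \<infinity>"
  shows "integrable M (\<lambda>\<omega>. (X \<omega>)\<^sup>2)"
    and "l2_size M (\<lambda>\<omega>. ereal (X \<omega>)) = ereal (sqrt (\<integral>\<omega>. (X \<omega>)\<^sup>2 \<partial>M))"
proof -
  have sq: "l2_size M (\<lambda>\<omega>. ereal (X \<omega>)) = ereal_sqrt (ereal_expectation M (\<lambda>\<omega>. ereal ((X \<omega>)\<^sup>2)))"
    by (simp add: l2_size_def power2_eq_square)
  have neg: "(\<integral>\<^sup>+\<omega>. e2ennreal (- ereal ((X \<omega>)\<^sup>2)) \<partial>M) = 0"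
    by (simp add: ennreal_neg)
  have "ereal_expectation M (\<lambda>\<omega>. ereal ((X \<omega>)\<^sup>2)) \<ge> 0"
    unfolding ereal_expectation_def neg zero_ennreal.rep_eq by simp
  then show int: "integrable M (\<lambda>\<omega>. (X \<omega>)\<^sup>2)"
    using assms sq by (intro integrable_if_ereal_expectation_finite) (auto simp: ereal_sqrt_def)
  show "l2_size M (\<lambda>\<omega>. ereal (X \<omega>)) = ereal (sqrt (\<integral>\<omega>. (X \<omega>)\<^sup>2 \<partial>M))"
    unfolding sq ereal_expectation_eq_integral[OF int] by (simp add: ereal_sqrt_def)
qed


section \<open>Averages with interspersed maxima\<close>

text \<open>
  The recursion of the models for a sequence of numbers, with the index shifted so that step \<open>m\<close>
  consumes \<open>y m\<close>; \<open>C\<close> is the set of steps that take a maximum.  For \<open>C = {}\<close> this is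
  exponential smoothing, a weighted average of \<open>y 0, \<dots>, y m\<close>.
\<close>

fun running_max :: "real \<Rightarrow> nat set \<Rightarrow> (nat \<Rightarrow> real) \<Rightarrow> nat \<Rightarrow> real" where
  "running_max b C y 0 = y 0"
| "running_max b C y (Suc m) = (1 - b) * y (Suc m) +
     b * (if Suc m \<in> C then max (running_max b C y m) (y (Suc m)) else running_max b C y m)"

abbreviation smoothed :: "real \<Rightarrow> (nat \<Rightarrow> real) \<Rightarrow> nat \<Rightarrow> real" where
  "smoothed b \<equiv> running_max b {}"

lemma running_max_mono:
  assumes "0 \<le> b" "b \<le> 1" and "\<And>k. k \<le> m \<Longrightarrow> x k \<le> y k"
  shows "running_max b C x m \<le> running_max b C y m"
  using assms(3)
proof (induction m)
  case (Suc m)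
  then have "running_max b C x m \<le> running_max b C y m" "x (Suc m) \<le> y (Suc m)" by auto
  then have "(if Suc m \<in> C then max (running_max b C x m) (x (Suc m)) else running_max b C x m)
      \<le> (if Suc m \<in> C then max (running_max b C y m) (y (Suc m)) else running_max b C y m)"
    by (auto intro: max.mono simp del: running_max.simps)
  then show ?case
    using assms(1,2) \<open>x (Suc m) \<le> y (Suc m)\<close>
    unfolding running_max.simps by (intro add_mono mult_left_mono) simp_all
qed simp

text \<open>
  With \<open>E m\<close> for the excess over the average, a step with a maximum gives
  \<open>E (Suc m) = b * max (E m) (jump)\<close> and a step without gives \<open>E (Suc m) = b * E m\<close>.  So the
  largest damped jump bounds the excess.  It is replaced by the root of the sum of squares, which
  makes the second moments of the jumps suffice for a bound on the expectation.
\<close>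

lemma running_max_le_average_plus_jumps:
  assumes "0 \<le> b"
  shows "running_max b C y m \<le> smoothed b y m +
    sqrt (\<Sum>k\<in>C \<inter> {1..m}. (b ^ (m + 1 - k) * (y k - smoothed b y (k - 1)))\<^sup>2)"
proof (induction m)
  case (Suc m)
  define S where "S = (\<Sum>k\<in>C \<inter> {1..m}. (b ^ (m + 1 - k) * (y k - smoothed b y (k - 1)))\<^sup>2)"
  define T where "T = (\<Sum>k\<in>C \<inter> {1..Suc m}. (b ^ (Suc m + 1 - k) * (y k - smoothed b y (k - 1)))\<^sup>2)"
  define J where "J = y (Suc m) - smoothed b y m"
  have IH: "running_max b C y m \<le> smoothed b y m + sqrt S"
    using Suc.IH by (simp add: S_def)
  have S0: "0 \<le> S" by (simp add: S_def sum_nonneg)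
  have old: "(\<Sum>k\<in>C \<inter> {1..m}. (b ^ (Suc m + 1 - k) * (y k - smoothed b y (k - 1)))\<^sup>2) = b\<^sup>2 * S"
    unfolding S_def sum_distrib_left
    by (rule sum.cong) (auto simp: Suc_diff_le power_mult_distrib)
  have T: "T = b\<^sup>2 * S + (if Suc m \<in> C then (b * J)\<^sup>2 else 0)"
  proof (cases "Suc m \<in> C")
    case True
    then have "C \<inter> {1..Suc m} = insert (Suc m) (C \<inter> {1..m})" by auto
    then show ?thesis using True old by (simp add: T_def J_def)
  next
    case False
    then have "C \<inter> {1..Suc m} = C \<inter> {1..m}" by (auto simp: le_Suc_eq)
    then show ?thesis using False old by (simp add: T_def)
  qed
  have bS: "b * sqrt S \<le> sqrt T"
    using assms S0 T by (intro real_le_rsqrt) (auto simp: power_mult_distrib)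
  have "running_max b C y (Suc m) \<le> smoothed b y (Suc m) + sqrt T"
  proof (cases "Suc m \<in> C")
    case True
    have bJ: "b * J \<le> sqrt T"
      using True S0 T by (intro real_le_rsqrt) auto
    have "b * max (running_max b C y m) (y (Suc m)) \<le> b * smoothed b y m + sqrt T"
    proof (cases "running_max b C y m \<le> y (Suc m)")
      case True
      then show ?thesis using bJ by (simp add: J_def algebra_simps)
    next
      case False
      then show ?thesis using mult_left_mono[OF IH assms] bS by (simp add: algebra_simps)
    qed
    then show ?thesis using True by simp
  next
    case False
    then show ?thesis using mult_left_mono[OF IH assms] bS by (simp add: algebra_simps)
  qed
  then show ?case by (simp add: T_def)
qed simp

lemma running_max_le_average_plus_damped_jumps:
  assumes "0 \<le> b" "b \<le> 1" and "C \<subseteq> {1..m}" and "\<And>k. k \<in> C \<Longrightarrow> n \<le> m + 1 - k"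
  shows "running_max b C y m \<le> smoothed b y m +
    b ^ n * sqrt (\<Sum>k\<in>C. (y k - smoothed b y (k - 1))\<^sup>2)"
proof -
  have "(\<Sum>k\<in>C \<inter> {1..m}. (b ^ (m + 1 - k) * (y k - smoothed b y (k - 1)))\<^sup>2)
      \<le> (\<Sum>k\<in>C. (b ^ n)\<^sup>2 * (y k - smoothed b y (k - 1))\<^sup>2)"
    unfolding Int_absorb2[OF assms(3)] power_mult_distrib
  proof (rule sum_mono)
    fix k assume "k \<in> C"
    then have "b ^ (m + 1 - k) \<le> b ^ n" using assms by (intro power_decreasing) auto
    then show "(b ^ (m + 1 - k))\<^sup>2 * (y k - smoothed b y (k - 1))\<^sup>2
        \<le> (b ^ n)\<^sup>2 * (y k - smoothed b y (k - 1))\<^sup>2"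
      using assms(1) by (intro mult_right_mono power_mono) auto
  qed
  then have "sqrt (\<Sum>k\<in>C \<inter> {1..m}. (b ^ (m + 1 - k) * (y k - smoothed b y (k - 1)))\<^sup>2)
      \<le> sqrt ((b ^ n)\<^sup>2 * (\<Sum>k\<in>C. (y k - smoothed b y (k - 1))\<^sup>2))"
    by (simp add: sum_distrib_left)
  also have "\<dots> = b ^ n * sqrt (\<Sum>k\<in>C. (y k - smoothed b y (k - 1))\<^sup>2)"
    using assms(1) by (simp add: real_sqrt_mult)
  finally show ?thesis
    using running_max_le_average_plus_jumps[OF assms(1), of C y m] by simp
qed


section \<open>Moments of the averages\<close>

lemma smoothed_expectation:
  fixes y :: "nat \<Rightarrow> 'w \<Rightarrow> real"
  assumes "\<And>k. k \<le> m \<Longrightarrow> integrable M (y k)" and "\<And>k. k \<le> m \<Longrightarrow> (\<integral>\<omega>. y k \<omega> \<partial>M) = c"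
  shows "integrable M (\<lambda>\<omega>. smoothed b (\<lambda>k. y k \<omega>) m) \<and>
    (\<integral>\<omega>. smoothed b (\<lambda>k. y k \<omega>) m \<partial>M) = c"
  using assms
proof (induction m)
  case (Suc m)
  then have "integrable M (\<lambda>\<omega>. smoothed b (\<lambda>k. y k \<omega>) m)"
    "(\<integral>\<omega>. smoothed b (\<lambda>k. y k \<omega>) m \<partial>M) = c" by auto
  moreover have "integrable M (y (Suc m))" "(\<integral>\<omega>. y (Suc m) \<omega> \<partial>M) = c"
    using Suc.prems by auto
  ultimately show ?case by (simp add: left_diff_distrib)
qed simp

lemma smoothed_second_moment:
  fixes y :: "nat \<Rightarrow> 'w \<Rightarrow> real"
  assumes "0 \<le> b" "b \<le> 1"
    and "\<And>k. k \<le> m \<Longrightarrow> y k \<in> borel_measurable M"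
    and "\<And>k. k \<le> m \<Longrightarrow> integrable M (\<lambda>\<omega>. (y k \<omega> - c)\<^sup>2)"
    and "\<And>k. k \<le> m \<Longrightarrow> (\<integral>\<omega>. (y k \<omega> - c)\<^sup>2 \<partial>M) \<le> V"
  shows "(\<lambda>\<omega>. smoothed b (\<lambda>k. y k \<omega>) m) \<in> borel_measurable M \<and>
    integrable M (\<lambda>\<omega>. (smoothed b (\<lambda>k. y k \<omega>) m - c)\<^sup>2) \<and>
    (\<integral>\<omega>. (smoothed b (\<lambda>k. y k \<omega>) m - c)\<^sup>2 \<partial>M) \<le> V"
  using assms(3-)
proof (induction m)
  case (Suc m)
  define a where "a \<omega> = smoothed b (\<lambda>k. y k \<omega>) m" for \<omega>
  define w where "w \<omega> = y (Suc m) \<omega>" for \<omega>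
  have a: "a \<in> borel_measurable M" "integrable M (\<lambda>\<omega>. (a \<omega> - c)\<^sup>2)" "(\<integral>\<omega>. (a \<omega> - c)\<^sup>2 \<partial>M) \<le> V"
    using Suc unfolding a_def by auto
  have w: "w \<in> borel_measurable M" "integrable M (\<lambda>\<omega>. (w \<omega> - c)\<^sup>2)" "(\<integral>\<omega>. (w \<omega> - c)\<^sup>2 \<partial>M) \<le> V"
    using Suc.prems[of "Suc m"] unfolding w_def by auto
  (* convexity of the square *)
  have conv: "((1 - b) * w \<omega> + b * a \<omega> - c)\<^sup>2 \<le> (1 - b) * (w \<omega> - c)\<^sup>2 + b * (a \<omega> - c)\<^sup>2" for \<omega>
  proof -
    have "(1 - b) * (w \<omega> - c)\<^sup>2 + b * (a \<omega> - c)\<^sup>2 - ((1 - b) * w \<omega> + b * a \<omega> - c)\<^sup>2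
        = b * (1 - b) * (w \<omega> - a \<omega>)\<^sup>2"
      by algebra
    moreover have "0 \<le> b * (1 - b) * (w \<omega> - a \<omega>)\<^sup>2" using assms(1,2) by simp
    ultimately show ?thesis by linarith
  qed
  have meas: "(\<lambda>\<omega>. (1 - b) * w \<omega> + b * a \<omega>) \<in> borel_measurable M"
    using a(1) w(1) by simp
  have bound: "integrable M (\<lambda>\<omega>. (1 - b) * (w \<omega> - c)\<^sup>2 + b * (a \<omega> - c)\<^sup>2)"
    using a w by simp
  have int: "integrable M (\<lambda>\<omega>. ((1 - b) * w \<omega> + b * a \<omega> - c)\<^sup>2)"
    using a(1) w(1) conv
    by (intro Bochner_Integration.integrable_bound[OF bound]) (auto intro: order_trans abs_ge_self)
  have "(\<integral>\<omega>. ((1 - b) * w \<omega> + b * a \<omega> - c)\<^sup>2 \<partial>M)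
      \<le> (\<integral>\<omega>. (1 - b) * (w \<omega> - c)\<^sup>2 + b * (a \<omega> - c)\<^sup>2 \<partial>M)"
    by (intro integral_mono int bound conv)
  also have "\<dots> = (1 - b) * (\<integral>\<omega>. (w \<omega> - c)\<^sup>2 \<partial>M) + b * (\<integral>\<omega>. (a \<omega> - c)\<^sup>2 \<partial>M)"
    using a w by simp
  also have "\<dots> \<le> (1 - b) * V + b * V"
    using a w assms(1,2) by (intro add_mono mult_left_mono) auto
  finally have "(\<integral>\<omega>. ((1 - b) * w \<omega> + b * a \<omega> - c)\<^sup>2 \<partial>M) \<le> V"
    by (simp add: algebra_simps)
  then show ?case
    using int meas
    by (simp add: a_def w_def)
qed simp

lemma second_moment_diff:
  fixes X Y :: "'w \<Rightarrow> real"
  assumes "X \<in> borel_measurable M" "integrable M (\<lambda>\<omega>. (X \<omega> - c)\<^sup>2)" "(\<integral>\<omega>. (X \<omega> - c)\<^sup>2 \<partial>M) \<le> V"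
    and "Y \<in> borel_measurable M" "integrable M (\<lambda>\<omega>. (Y \<omega> - c)\<^sup>2)" "(\<integral>\<omega>. (Y \<omega> - c)\<^sup>2 \<partial>M) \<le> V"
  shows "integrable M (\<lambda>\<omega>. (X \<omega> - Y \<omega>)\<^sup>2)" and "(\<integral>\<omega>. (X \<omega> - Y \<omega>)\<^sup>2 \<partial>M) \<le> 4 * V"
proof -
  have le: "(X \<omega> - Y \<omega>)\<^sup>2 \<le> 2 * (X \<omega> - c)\<^sup>2 + 2 * (Y \<omega> - c)\<^sup>2" for \<omega>
  proof -
    have "2 * (X \<omega> - c)\<^sup>2 + 2 * (Y \<omega> - c)\<^sup>2 - (X \<omega> - Y \<omega>)\<^sup>2 = (X \<omega> + Y \<omega> - 2 * c)\<^sup>2"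
      by algebra
    moreover have "0 \<le> (X \<omega> + Y \<omega> - 2 * c)\<^sup>2" by simp
    ultimately show ?thesis by linarith
  qed
  have bound: "integrable M (\<lambda>\<omega>. 2 * (X \<omega> - c)\<^sup>2 + 2 * (Y \<omega> - c)\<^sup>2)"
    using assms by simp
  show int: "integrable M (\<lambda>\<omega>. (X \<omega> - Y \<omega>)\<^sup>2)"
    using assms(1,4) le
    by (intro Bochner_Integration.integrable_bound[OF bound]) (auto intro: order_trans abs_ge_self)
  have "(\<integral>\<omega>. (X \<omega> - Y \<omega>)\<^sup>2 \<partial>M) \<le> (\<integral>\<omega>. 2 * (X \<omega> - c)\<^sup>2 + 2 * (Y \<omega> - c)\<^sup>2 \<partial>M)"
    by (intro integral_mono int bound le)
  also have "\<dots> \<le> 4 * V" using assms by simp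
  finally show "(\<integral>\<omega>. (X \<omega> - Y \<omega>)\<^sup>2 \<partial>M) \<le> 4 * V" .
qed

lemma (in prob_space) expectation_sqrt_le:
  fixes Q :: "'a \<Rightarrow> real"
  assumes "integrable M Q" and "\<And>\<omega>. 0 \<le> Q \<omega>"
  shows "integrable M (\<lambda>\<omega>. sqrt (Q \<omega>))" and "expectation (\<lambda>\<omega>. sqrt (Q \<omega>)) \<le> sqrt (expectation Q)"
proof -
  have sq: "(\<lambda>\<omega>. (sqrt (Q \<omega>))\<^sup>2) = Q"
    using assms(2) by auto
  have m: "(\<lambda>\<omega>. sqrt (Q \<omega>)) \<in> borel_measurable M"
    using assms(1) by measurable
  show int: "integrable M (\<lambda>\<omega>. sqrt (Q \<omega>))"
    by (rule square_integrable_imp_integrable[OF m]) (simp only: sq assms(1))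
  have "0 \<le> variance (\<lambda>\<omega>. sqrt (Q \<omega>))"
    by (rule variance_positive)
  also have "\<dots> = expectation Q - (expectation (\<lambda>\<omega>. sqrt (Q \<omega>)))\<^sup>2"
    using variance_eq[OF int] assms(1) by (simp only: sq)
  finally show "expectation (\<lambda>\<omega>. sqrt (Q \<omega>)) \<le> sqrt (expectation Q)"
    by (intro real_le_rsqrt) simp
qed

lemma (in prob_space) expected_size_of_jumps:
  fixes y :: "nat \<Rightarrow> 'a \<Rightarrow> real"
  assumes "0 \<le> b" "b \<le> 1" and "C \<subseteq> {1..m}"
    and "\<And>k. k \<le> m \<Longrightarrow> y k \<in> borel_measurable M"
    and "\<And>k. k \<le> m \<Longrightarrow> integrable M (\<lambda>\<omega>. (y k \<omega> - c)\<^sup>2)"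
    and "\<And>k. k \<le> m \<Longrightarrow> expectation (\<lambda>\<omega>. (y k \<omega> - c)\<^sup>2) \<le> V"
  shows "integrable M (\<lambda>\<omega>. sqrt (\<Sum>k\<in>C. (y k \<omega> - smoothed b (\<lambda>k. y k \<omega>) (k - 1))\<^sup>2))" (is ?I)
    and "expectation (\<lambda>\<omega>. sqrt (\<Sum>k\<in>C. (y k \<omega> - smoothed b (\<lambda>k. y k \<omega>) (k - 1))\<^sup>2))
      \<le> 2 * sqrt V * sqrt (card C)" (is ?E)
proof -
  define J where "J k \<omega> = (y k \<omega> - smoothed b (\<lambda>k. y k \<omega>) (k - 1))\<^sup>2" for k \<omega>
  have J: "integrable M (J k)" "expectation (J k) \<le> 4 * V" if "k \<in> C" for k
  proof -
    have k: "k \<le> m" using that assms(3) by auto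
    have sm: "(\<lambda>\<omega>. smoothed b (\<lambda>k. y k \<omega>) (k - 1)) \<in> borel_measurable M \<and>
      integrable M (\<lambda>\<omega>. (smoothed b (\<lambda>k. y k \<omega>) (k - 1) - c)\<^sup>2) \<and>
      expectation (\<lambda>\<omega>. (smoothed b (\<lambda>k. y k \<omega>) (k - 1) - c)\<^sup>2) \<le> V"
      by (rule smoothed_second_moment) (use assms k in auto)
    show "integrable M (J k)" "expectation (J k) \<le> 4 * V"
      unfolding J_def
      using second_moment_diff[of "y k" M c V "\<lambda>\<omega>. smoothed b (\<lambda>k. y k \<omega>) (k - 1)"] sm assms(4-6) k
      by auto
  qed
  have int: "integrable M (\<lambda>\<omega>. \<Sum>k\<in>C. J k \<omega>)" using J by simp
  have nonneg: "0 \<le> (\<Sum>k\<in>C. J k \<omega>)" for \<omega> by (simp add: J_def sum_nonneg)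
  show ?I
    using expectation_sqrt_le(1)[OF int nonneg] by (simp add: J_def)
  have "expectation (\<lambda>\<omega>. \<Sum>k\<in>C. J k \<omega>) = (\<Sum>k\<in>C. expectation (J k))"
    using J by simp
  also have "\<dots> \<le> (\<Sum>k\<in>C. 4 * V)" by (intro sum_mono J)
  also have "\<dots> = 2\<^sup>2 * V * card C" by simp
  finally have "sqrt (expectation (\<lambda>\<omega>. \<Sum>k\<in>C. J k \<omega>)) \<le> sqrt (2\<^sup>2 * V * card C)"
    by simp
  also have "\<dots> = 2 * sqrt V * sqrt (card C)"
    by (simp only: real_sqrt_mult real_sqrt_power) simp
  finally show ?E
    using expectation_sqrt_le(2)[OF int nonneg] by (simp add: J_def)
qed


section \<open>The models of the method\<close>

lemma smax_beta_bounds: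
  assumes "N \<ge> 1"
  shows "0 \<le> smax_beta N" "smax_beta N < 1"
    and "smax_beta N \<le> exp (- (ln (real N + 1) / (real N + 1)))"
proof -
  define a where "a = real N + 1"
  define L where "L = ln a"
  have a: "a > 1" using assms by (simp add: a_def)
  have L: "0 < L" "L \<le> a" using a ln_le_minus_one[of a] by (auto simp: L_def)
  have b: "smax_beta N = (a - L) / (a + L)" by (simp add: smax_beta_def a_def L_def)
  show "0 \<le> smax_beta N" "smax_beta N < 1" using a L by (auto simp: b divide_simps)
  have "(a - L) / (a + L) \<le> (a - L) / a"
    using a L by (intro divide_left_mono) auto
  also have "\<dots> = 1 + - (L / a)" using a by (simp add: field_simps)
  also have "\<dots> \<le> exp (- (L / a))" by (rule exp_ge_add_one_self)
  finally show "smax_beta N \<le> exp (- (ln (real N + 1) / (real N + 1)))"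
    by (simp add: b a_def L_def)
qed

lemma smax_beta_power_le:
  assumes "N \<ge> 1" and "N + 1 \<le> 2 * n"
  shows "smax_beta N ^ n \<le> 1 / sqrt (real N + 1)"
proof -
  define a where "a = real N + 1"
  have a: "a > 1" using assms by (simp add: a_def)
  have "smax_beta N ^ n \<le> exp (- (ln a / a)) ^ n"
    using smax_beta_bounds[OF assms(1)] by (intro power_mono) (auto simp: a_def)
  also have "\<dots> = exp (- (real n * (ln a / a)))"
    by (simp add: exp_of_nat_mult[symmetric])
  also have "\<dots> \<le> exp (- (ln a / 2))"
  proof -
    have "a / 2 * (ln a / a) \<le> real n * (ln a / a)"
      using assms(2) a by (intro mult_right_mono) (auto simp: a_def)
    then show ?thesis using a by simp
  qed
  also have "\<dots> = 1 / sqrt a"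
    using a by (simp add: exp_minus inverse_eq_divide ln_sqrt[symmetric])
  finally show ?thesis by (simp add: a_def)
qed

text \<open>The steps that take a maximum, in the indexing of \<open>running_max\<close>: model \<open>j\<close> uses sample \<open>j - 1\<close>.\<close>

abbreviation max_steps :: "nat set \<Rightarrow> nat set" where
  "max_steps B \<equiv> {k. 1 \<le> k \<and> Suc k \<in> B}"

lemma card_max_steps:
  assumes "finite B" and "1 \<in> B" and "0 \<notin> B"
  shows "card (max_steps B) = card B - 1"
proof -
  have "Suc ` max_steps B = B - {1}"
  proof
    show "B - {1} \<subseteq> Suc ` max_steps B"
    proof
      fix j assume "j \<in> B - {1}"
      then show "j \<in> Suc ` max_steps B"
        using assms(3) by (cases j) (auto intro!: image_eqI[of _ _ "j - 1"])
    qed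
  qed auto
  moreover have "card (Suc ` max_steps B) = card (max_steps B)"
    by (rule card_image) simp
  ultimately show ?thesis using assms by simp
qed

lemma smax1c_runD:
  assumes "smax1c_run h F s lam N B z0 xs G z"
  shows "z 0 = z0" and "G 1 x = stoch_lin h F s z0 (xs 0) x"
    and "j \<in> {2..N} \<Longrightarrow> G j x =
      ereal (1 - smax_beta N) * stoch_lin h F s (z (j - 1)) (xs (j - 1)) x + ereal (smax_beta N) *
        (if j \<in> B then max (G (j - 1) x) (stoch_lin h F s (z (j - 1)) (xs (j - 1)) x)
         else G (j - 1) x)"
    and "j \<in> {1..N} \<Longrightarrow>
      is_arg_min (\<lambda>u. G j u + ereal (1 / (2 * lam) * (norm (u - z0))\<^sup>2)) (\<lambda>_. True) (z j)"
  using assms unfolding smax1c_run_def Let_def by blast+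

lemma model_eq_running_max:
  assumes run: "smax1c_run h F s lam N B z0 xs G z" and hx: "h x = ereal r" and "m < N"
  shows "G (Suc m) x = ereal (running_max (smax_beta N) (max_steps B)
     (\<lambda>k. F (z k) (xs k) + r + s (z k) (xs k) \<bullet> (x - z k)) m)"
  using \<open>m < N\<close>
proof (induction m)
  case 0
  then show ?case using smax1c_runD(1,2)[OF run] hx by (simp add: stoch_lin_def)
next
  case (Suc m)
  then have "Suc (Suc m) \<in> {2..N}" by auto
  then have "G (Suc (Suc m)) x = ereal (1 - smax_beta N) * stoch_lin h F s (z (Suc m)) (xs (Suc m)) x
     + ereal (smax_beta N) * (if Suc (Suc m) \<in> B
         then max (G (Suc m) x) (stoch_lin h F s (z (Suc m)) (xs (Suc m)) x) else G (Suc m) x)"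
    using smax1c_runD(3)[OF run, of "Suc (Suc m)" x] by simp
  then show ?case
    using Suc hx by (simp add: stoch_lin_def max_def)
qed

text \<open>
  The prox objective is \<open>\<infinity>\<close> outside the domain of \<open>h\<close>, because \<open>\<infinity>\<close> absorbs every summand and
  the newest linearization has positive weight; at \<open>z0\<close> it is finite.
\<close>

lemma iterate_in_domain:
  assumes run: "smax1c_run h F s lam N B z0 xs G z" and "z0 \<in> effective_domain h"
    and ninf: "\<And>x. h x \<noteq> - \<infinity>" and "j \<le> N"
  shows "z j \<in> effective_domain h"
proof (cases "j = 0")
  case True
  then show ?thesis using smax1c_runD(1)[OF run] assms(2) by simp
next
  case False
  then have j: "1 \<le> j" "j \<le> N" using \<open>j \<le> N\<close> by auto
  obtain r where "h z0 = ereal r"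
    using assms(2) ninf[of z0] by (cases "h z0") (auto simp: effective_domain_def)
  from model_eq_running_max[OF run this, of "j - 1"] j
  obtain q where q: "G j z0 = ereal q" by auto
  have "\<not> G j z0 + ereal (1 / (2 * lam) * (norm (z0 - z0))\<^sup>2)
      < G j (z j) + ereal (1 / (2 * lam) * (norm (z j - z0))\<^sup>2)"
    using smax1c_runD(4)[OF run, of j] j unfolding is_arg_min_def atLeastAtMost_iff by blast
  then have fin: "G j (z j) \<noteq> \<infinity>" using q by auto
  show ?thesis
  proof (rule ccontr)
    assume "z j \<notin> effective_domain h"
    then have top: "h (z j) = \<infinity>" by (simp add: effective_domain_def)
    have lin: "stoch_lin h F s x \<xi> (z j) = \<infinity>" for x \<xi>
      by (simp add: stoch_lin_def top)
    have "G j (z j) = \<infinity>"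
    proof (cases "j = 1")
      case True
      then show ?thesis using smax1c_runD(2)[OF run, of "z 1"] lin by simp
    next
      case False
      then have "j \<in> {2..N}" using j by auto
      then have "G j (z j) = ereal (1 - smax_beta N) * \<infinity> + ereal (smax_beta N) *
          (if j \<in> B then max (G (j - 1) (z j)) \<infinity> else G (j - 1) (z j))"
        using smax1c_runD(3)[OF run, of j "z j"] by (simp only: lin)
      moreover have "ereal (1 - smax_beta N) * \<infinity> = \<infinity>"
        using smax_beta_bounds(2)[of N] j by simp
      ultimately show ?thesis by simp
    qed
    with fin show False ..
  qed
qed

lemma model_le_running_max:
  assumes run: "smax1c_run h F s lam N B z0 xs G z" and "z0 \<in> effective_domain h"
    and ninf: "\<And>x. h x \<noteq> - \<infinity>" and hx: "h x = ereal r" and "N \<ge> 1"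
    and sub: "\<And>k v. k < N \<Longrightarrow> v \<in> effective_domain h \<Longrightarrow>
       F v (xs k) + s v (xs k) \<bullet> (x - v) \<le> F x (xs k)"
  shows "G N x \<le> ereal (running_max (smax_beta N) (max_steps B) (\<lambda>k. F x (xs k) + r) (N - 1))"
proof -
  have "running_max (smax_beta N) (max_steps B)
      (\<lambda>k. F (z k) (xs k) + r + s (z k) (xs k) \<bullet> (x - z k)) (N - 1)
    \<le> running_max (smax_beta N) (max_steps B) (\<lambda>k. F x (xs k) + r) (N - 1)"
  proof (rule running_max_mono)
    fix k assume "k \<le> N - 1"
    then have "k < N" using \<open>N \<ge> 1\<close> by auto
    then show "F (z k) (xs k) + r + s (z k) (xs k) \<bullet> (x - z k) \<le> F x (xs k) + r"
      using sub[of k "z k"] iterate_in_domain[OF run assms(2) ninf, of k] by simp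
  qed (use smax_beta_bounds[OF \<open>N \<ge> 1\<close>] in auto)
  then show ?thesis
    using model_eq_running_max[where m = "N - 1", OF run hx] \<open>N \<ge> 1\<close> by simp
qed


section \<open>The noise of the last model\<close>


theorem proposition3p4:
  fixes f h :: "'a::euclidean_space \<Rightarrow> ereal"
    and F :: "'a \<Rightarrow> 'b::euclidean_space \<Rightarrow> real"
    and s :: "'a \<Rightarrow> 'b \<Rightarrow> 'a"
    and D :: "'b measure"
    and M :: "'w measure"
    and xi :: "nat \<Rightarrow> 'w \<Rightarrow> 'b"
    and lam :: real and N :: nat and B :: "nat set" and z0 u :: 'a
    and G :: "nat \<Rightarrow> 'w \<Rightarrow> 'a \<Rightarrow> ereal"
    and z :: "nat \<Rightarrow> 'w \<Rightarrow> 'a"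
  assumes "prob_space D" and "sets D = sets borel"
    \<comment> \<open>the problem and its oracles\<close>
    and "proper_closed_convex f" and "proper_closed_convex h"
    and "effective_domain h \<subseteq> effective_domain f"
    and "\<And>x. x \<in> effective_domain h \<Longrightarrow> F x \<in> borel_measurable D"
    and "\<And>x. x \<in> effective_domain h \<Longrightarrow> s x \<in> borel_measurable D"
    and "AE \<xi> in D. convex_on (effective_domain h) (\<lambda>x. F x \<xi>)"
    and "\<And>x. x \<in> effective_domain h \<Longrightarrow> f x = ereal_expectation D (\<lambda>\<xi>. ereal (F x \<xi>))"
    and "AE \<xi> in D. \<forall>x\<in>effective_domain h. \<forall>v\<in>effective_domain h.
           F v \<xi> \<ge> F x \<xi> + s x \<xi> \<bullet> (v - x)"
    and "(SUP x\<in>effective_domain h. l2_size D (\<lambda>\<xi>. ereal (norm (s x \<xi>)))) < \<infinity>"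
    and "\<exists>x. is_arg_min (obj f h) (\<lambda>_. True) x"
    \<comment> \<open>input of the method and independent samples\<close>
    and "N \<ge> 2" and "lam > 0"
    and "{1} \<subseteq> B" and "B \<subseteq> {1..N div 2}"
    and "z0 \<in> effective_domain h"
    and "prob_space M"
    and "prob_space.indep_vars M (\<lambda>_. borel) xi {0..N}"
    and "\<And>j. j \<in> {0..N} \<Longrightarrow> distr M borel (xi j) = D"
    \<comment> \<open>models and iterates generated by the method\<close>
    and "AE \<omega> in M. smax1c_run h F s lam N B z0 (\<lambda>j. xi j \<omega>) (\<lambda>j. G j \<omega>) (\<lambda>j. z j \<omega>)"
    and "\<And>j. j \<in> {1..N} \<Longrightarrow> z j \<in> borel_measurable M"
    and "\<And>j v. j \<in> {1..N} \<Longrightarrow> v \<in> effective_domain h \<Longrightarrow> (\<lambda>\<omega>. G j \<omega> v) \<in> borel_measurable M"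
    and "u \<in> effective_domain h"
  shows "model_noise M f h (G N) u
           \<le> 4 * noise_level D f h F u * ereal (sqrt (real (card B) - 1)) *
             ereal (sqrt (ln (real N + 1)) / sqrt (real N + 1))"
proof -
  note subgrad = assms(10)
  interpret M: prob_space M by fact
  define b where "b = smax_beta N"
  define C where "C = max_steps B"
  (* a jump at step k is damped at that step and all later ones, N - k times; k is at most N div 2 - 1 *)
  define n where "n = N - N div 2 + 1"
  have b: "0 \<le> b" "b \<le> 1"
    using smax_beta_bounds[of N] \<open>N \<ge> 2\<close> by (auto simp: b_def)
  have finB: "finite B"
    using \<open>B \<subseteq> {1..N div 2}\<close> finite_subset by blast
  have cardC: "card C = card B - 1" and card1: "1 \<le> card B"
  proof -
    have "1 \<in> B" "0 \<notin> B" using \<open>{1} \<subseteq> B\<close> \<open>B \<subseteq> {1..N div 2}\<close> by auto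
    then show "card C = card B - 1" unfolding C_def by (rule card_max_steps[OF finB])
    show "1 \<le> card B" using \<open>1 \<in> B\<close> finB by (auto simp: Suc_le_eq card_gt_0_iff)
  qed
  have C: "C \<subseteq> {1..N - 1}" and damp: "n \<le> N - 1 + 1 - k" if "k \<in> C" for k
    using that \<open>B \<subseteq> {1..N div 2}\<close> \<open>N \<ge> 2\<close> by (force simp: C_def n_def)+
  have power: "b ^ n \<le> 1 / sqrt (real N + 1)"
    using smax_beta_power_le[of N n] \<open>N \<ge> 2\<close> by (simp add: b_def n_def)

  have ninf: "h x \<noteq> - \<infinity>" "f x \<noteq> - \<infinity>" for x
    using \<open>proper_closed_convex h\<close> \<open>proper_closed_convex f\<close> by (auto simp: proper_closed_convex_def)
  obtain r where r: "h u = ereal r"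
    using \<open>u \<in> effective_domain h\<close> ninf(1)[of u] by (cases "h u") (auto simp: effective_domain_def)
  have fu: "f u \<noteq> \<infinity>"
    using \<open>u \<in> effective_domain h\<close> \<open>effective_domain h \<subseteq> effective_domain f\<close>
    by (auto simp: effective_domain_def)
  have Fm: "F u \<in> borel_measurable D"
    using assms(6) \<open>u \<in> effective_domain h\<close> .
  have fE: "f u = ereal_expectation D (\<lambda>\<xi>. ereal (F u \<xi>))"
    using assms(9) \<open>u \<in> effective_domain h\<close> .
  have Fint: "integrable D (F u)"
    using integrable_if_ereal_expectation_finite[OF Fm] fE fu ninf(2)[of u] by simp
  define c where "c = (\<integral>\<xi>. F u \<xi> \<partial>D) + r"
  have phi: "obj f h u = ereal c"
    using fE ereal_expectation_eq_integral[OF Fint] r by (simp add: obj_def c_def)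

  have xi: "xi k \<in> measurable M borel" if "k < N" for k
    using \<open>M.indep_vars (\<lambda>_. borel) xi {0..N}\<close> that by (auto simp: M.indep_vars_def)
  have D: "D = distr M borel (xi k)" if "k < N" for k
    using assms(20)[of k] that by simp
  have Fb: "F u \<in> borel_measurable borel"
    using Fm \<open>sets D = sets borel\<close> measurable_cong_sets by blast
  define y where "y k \<omega> = F u (xi k \<omega>) + r" for k \<omega>
  have ym: "y k \<in> borel_measurable M" if "k < N" for k
    unfolding y_def using measurable_compose[OF xi[OF that] Fb] by simp
  have yint: "integrable M (y k)" "(\<integral>\<omega>. y k \<omega> \<partial>M) = c" if "k < N" for k
  proof -
    have F: "integrable M (\<lambda>\<omega>. F u (xi k \<omega>))"
      using Fint integrable_distr[OF xi[OF that]] D[OF that] by metis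
    have "(\<integral>\<xi>. F u \<xi> \<partial>D) = (\<integral>\<omega>. F u (xi k \<omega>) \<partial>M)"
      using integral_distr[OF xi[OF that] Fb] D[OF that] by metis
    then show "integrable M (y k)" "(\<integral>\<omega>. y k \<omega> \<partial>M) = c"
      using F by (simp_all add: y_def[abs_def] c_def M.prob_space)
  qed
  have mean: "integrable M (\<lambda>\<omega>. smoothed b (\<lambda>k. y k \<omega>) (N - 1)) \<and>
      (\<integral>\<omega>. smoothed b (\<lambda>k. y k \<omega>) (N - 1) \<partial>M) = c"
    by (rule smoothed_expectation) (use yint \<open>N \<ge> 2\<close> in auto)

  (* one null set serves all samples and all points of the domain *)
  have "AE \<omega> in M. \<forall>k\<in>{..<N}. \<forall>v\<in>effective_domain h.
      F v (xi k \<omega>) + s v (xi k \<omega>) \<bullet> (u - v) \<le> F u (xi k \<omega>)"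
  proof (rule AE_finite_allI)
    fix k assume "k \<in> {..<N}"
    then have k: "k < N" by simp
    have "AE \<xi> in distr M borel (xi k). \<forall>v\<in>effective_domain h.
        F v \<xi> + s v \<xi> \<bullet> (u - v) \<le> F u \<xi>"
      using subgrad \<open>u \<in> effective_domain h\<close> unfolding D[OF k, symmetric] by auto
    then show "AE \<omega> in M. \<forall>v\<in>effective_domain h.
        F v (xi k \<omega>) + s v (xi k \<omega>) \<bullet> (u - v) \<le> F u (xi k \<omega>)"
      by (rule AE_distrD[OF xi[OF k]])
  qed simp
  with assms(21) have model: "AE \<omega> in M. G N \<omega> u \<le> ereal (running_max b C (\<lambda>k. y k \<omega>) (N - 1))"
  proof eventually_elim
    case (elim \<omega>)
    show ?case
      unfolding b_def C_def y_def
      by (rule model_le_running_max[OF elim(1) \<open>z0 \<in> effective_domain h\<close> ninf(1) r])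
         (use elim(2) \<open>N \<ge> 2\<close> in auto)
  qed

  define R where "R \<omega> = sqrt (\<Sum>k\<in>C. (y k \<omega> - smoothed b (\<lambda>k. y k \<omega>) (k - 1))\<^sup>2)" for \<omega>
  have upper: "model_noise M f h (G N) u \<le> ereal (b ^ n * (\<integral>\<omega>. R \<omega> \<partial>M))" if "integrable M R"
  proof -
    have "AE \<omega> in M. G N \<omega> u \<le> ereal (smoothed b (\<lambda>k. y k \<omega>) (N - 1) + b ^ n * R \<omega>)"
      using model
    proof eventually_elim
      case (elim \<omega>)
      have "C \<subseteq> {1..N - 1}" using C by blast
      then show ?case
        using elim running_max_le_average_plus_damped_jumps[OF b, of C "N - 1" n "\<lambda>k. y k \<omega>"] damp
        unfolding R_def by (meson ereal_less_eq(3) order_trans)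
    qed
    then have "ereal_expectation M (\<lambda>\<omega>. G N \<omega> u)
        \<le> ereal (\<integral>\<omega>. smoothed b (\<lambda>k. y k \<omega>) (N - 1) + b ^ n * R \<omega> \<partial>M)"
      by (rule ereal_expectation_le_integral) (use mean that in simp)
    also have "(\<integral>\<omega>. smoothed b (\<lambda>k. y k \<omega>) (N - 1) + b ^ n * R \<omega> \<partial>M) = c + b ^ n * (\<integral>\<omega>. R \<omega> \<partial>M)"
      using mean that by simp
    finally have "ereal_expectation M (\<lambda>\<omega>. G N \<omega> u) - ereal c \<le> ereal (b ^ n * (\<integral>\<omega>. R \<omega> \<partial>M))"
      by (cases "ereal_expectation M (\<lambda>\<omega>. G N \<omega> u)") auto
    moreover have "0 \<le> b ^ n * (\<integral>\<omega>. R \<omega> \<partial>M)"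
      using b by (simp add: R_def sum_nonneg)
    ultimately show ?thesis
      by (simp add: model_noise_def phi)
  qed

  have noise: "noise_level D f h F u = l2_size D (\<lambda>\<xi>. ereal (F u \<xi> + r - c))"
    by (simp add: noise_level_def stoch_obj_def phi r)
  have root: "1 \<le> sqrt (ln (real N + 1))"
  proof -
    have "exp 1 \<le> real N + 1" using exp_le \<open>N \<ge> 2\<close> by linarith
    then have "ln (exp 1) \<le> ln (real N + 1)" by (subst ln_le_cancel_iff) auto
    then show ?thesis by simp
  qed
  show ?thesis
  proof (cases "noise_level D f h F u = \<infinity>")
    case True
    show ?thesis
    proof (cases "card B = 1")
      case True
      (* no maximum is ever taken: the bound is \<infinity> * 0 = 0, and the upper model is a plain average *)
      have "finite C" using C by (meson finite_atLeastAtMost finite_subset subsetI)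
      then have "C = {}" using cardC True by simp
      then have "integrable M R" "(\<integral>\<omega>. R \<omega> \<partial>M) = 0" by (simp_all add: R_def[abs_def])
      then show ?thesis using upper True by (simp add: zero_ereal_def[symmetric])
    next
      case False
      then have "0 < sqrt (real (card B) - 1)" using card1 by simp
      moreover have "0 < sqrt (ln (real N + 1)) / sqrt (real N + 1)"
        using root \<open>N \<ge> 2\<close> by (intro divide_pos_pos) auto
      ultimately have "4 * noise_level D f h F u * ereal (sqrt (real (card B) - 1)) *
          ereal (sqrt (ln (real N + 1)) / sqrt (real N + 1)) = \<infinity>"
        unfolding \<open>noise_level D f h F u = \<infinity>\<close>
        using \<open>N \<ge> 2\<close> by simp
      then show ?thesis by (simp only: ereal_less_eq(1))
    qed
  next
    case False
    define V where "V = (\<integral>\<xi>. (F u \<xi> + r - c)\<^sup>2 \<partial>D)"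
    have m: "(\<lambda>\<xi>. F u \<xi> + r - c) \<in> borel_measurable D" using Fm by simp
    have sq: "integrable D (\<lambda>\<xi>. (F u \<xi> + r - c)\<^sup>2)" and sigma: "noise_level D f h F u = ereal (sqrt V)"
      using l2_size_finite[OF m] False noise by (auto simp: V_def)
    have V0: "0 \<le> V" by (simp add: V_def)
    have y2: "integrable M (\<lambda>\<omega>. (y k \<omega> - c)\<^sup>2)" "(\<integral>\<omega>. (y k \<omega> - c)\<^sup>2 \<partial>M) \<le> V" if "k < N" for k
    proof -
      have mb: "(\<lambda>\<xi>. (F u \<xi> + r - c)\<^sup>2) \<in> borel_measurable borel" using Fb by simp
      show "integrable M (\<lambda>\<omega>. (y k \<omega> - c)\<^sup>2)"
        using sq integrable_distr[OF xi[OF that], of "\<lambda>\<xi>. (F u \<xi> + r - c)\<^sup>2"] D[OF that]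
        unfolding y_def by metis
      show "(\<integral>\<omega>. (y k \<omega> - c)\<^sup>2 \<partial>M) \<le> V"
        using integral_distr[OF xi[OF that] mb] D[OF that] unfolding y_def V_def by (metis order_refl)
    qed
    have "C \<subseteq> {1..N - 1}" using C by blast
    then have R: "integrable M R" "(\<integral>\<omega>. R \<omega> \<partial>M) \<le> 2 * sqrt V * sqrt (card C)"
      unfolding R_def[abs_def]
      using M.expected_size_of_jumps[OF b, of C "N - 1" y c V] ym y2 \<open>N \<ge> 2\<close> by auto
    have "b ^ n * (\<integral>\<omega>. R \<omega> \<partial>M) \<le> 1 / sqrt (real N + 1) * (2 * sqrt V * sqrt (card C))"
      using R(2) power b by (intro mult_mono) (auto simp: R_def sum_nonneg)
    also have "\<dots> \<le> sqrt (ln (real N + 1)) / sqrt (real N + 1) * (4 * sqrt V * sqrt (card C))"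
      using root V0 by (intro mult_mono divide_right_mono) auto
    also have "\<dots> = 4 * sqrt V * sqrt (real (card B) - 1) * (sqrt (ln (real N + 1)) / sqrt (real N + 1))"
      using card1 by (simp add: cardC of_nat_diff)
    finally show ?thesis
      using upper[OF R(1)] unfolding sigma
      by (metis ereal_less_eq(3) numeral_eq_ereal order_trans times_ereal.simps(1))
  qed
qed

end
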